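(* Let $D$ be a diagram with $|G(D)|=0$. Then the ghost Kohnert poset $\mathcal{P}_G(D)$ is a lattice if and only if it is bounded.
   Context: A diagram is a finite set of cells placed at positions $(r,c)\in\mathbb{Z}_{>0}\times\mathbb{Z}_{>0}$ ($r$ the row, counted from the bottom; $c$ the column), each position holding at most one cell; each cell is either an ordinary cell, written $(r,c)$, or a ghost cell, written $\langle r,c\rangle$. A position is empty if it holds no cell of either kind. $G(D)$ denotes the set of ghost cells of $D$. The ghost move at row $r$ of $D$, with result denoted $\mathcal{G}(D,r)$, is defined as follows: if row $r$ is empty, $\mathcal{G}(D,r)=D$. Otherwise let $c$ be the largest column of a cell in row $r$. If this rightmost cell is a ghost cell, or there is no empty position $(\hat r,c)$ with $\hat r<r$, or, letting $\hat r<r$ be maximal with $(\hat r,c)$ empty, there is a ghost cell $\langle r^*,c\rangle$ with $\hat r<r^*<r$, then $\mathcal{G}(D,r)=D$. Otherwise, with $\hat r<r$ maximal such that $(\hat r,c)$ is empty, $\mathcal{G}(D,r)=(D\setminus\{(r,c)\})\cup\{(\hat r,c),\langle r,c\rangle\}$. $\mathrm{GKD}(D)$ is the set of all diagrams obtainable from $D$ by finite (possibly empty) sequences of ghost moves. The ghost Kohnert poset $\mathcal{P}_G(D)$ has underlying set $\mathrm{GKD}(D)$, with $D_2\preceq D_1$ iff $D_2$ can be obtained from $D_1$ by a finite (possibly empty) sequence of ghost moves. A poset is bounded if it has a unique minimal element and a unique maximal element. *)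

theory Defs
  imports "HOL-Algebra.Lattice"
begin

datatype cell = Ordinary nat nat | Ghost nat nat

primrec cell_row :: "cell \<Rightarrow> nat" where
  "cell_row (Ordinary r c) = r"
| "cell_row (Ghost r c) = r"

primrec cell_col :: "cell \<Rightarrow> nat" where
  "cell_col (Ordinary r c) = c"
| "cell_col (Ghost r c) = c"

definition is_diagram :: "cell set \<Rightarrow> bool" where
  "is_diagram D \<longleftrightarrow>
     finite D \<and>
     (\<forall>x\<in>D. 0 < cell_row x \<and> 0 < cell_col x) \<and>
     (\<forall>r c. \<not> (Ordinary r c \<in> D \<and> Ghost r c \<in> D))"

definition ghost_cells :: "cell set \<Rightarrow> cell set" where
  "ghost_cells D = {x \<in> D. \<exists>r c. x = Ghost r c}"

definition empty_position :: "cell set \<Rightarrow> nat \<Rightarrow> nat \<Rightarrow> bool" where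
  "empty_position D r c \<longleftrightarrow> Ordinary r c \<notin> D \<and> Ghost r c \<notin> D"

definition row_columns :: "cell set \<Rightarrow> nat \<Rightarrow> nat set" where
  "row_columns D r = {c. \<not> empty_position D r c}"

text \<open>Rows are numbered from 1, so row 0 never receives a cell.\<close>

definition empty_rows_below :: "cell set \<Rightarrow> nat \<Rightarrow> nat \<Rightarrow> nat set" where
  "empty_rows_below D r c = {s. 0 < s \<and> s < r \<and> empty_position D s c}"

definition ghost_move :: "cell set \<Rightarrow> nat \<Rightarrow> cell set" where
  "ghost_move D r =
     (if row_columns D r = {} then D
      else let c = Max (row_columns D r); S = empty_rows_below D r c in
        if Ghost r c \<in> D \<or> S = {} \<or> (\<exists>t. Max S < t \<and> t < r \<and> Ghost t c \<in> D) then D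
        else (D - {Ordinary r c}) \<union> {Ordinary (Max S) c, Ghost r c})"

definition ghost_step :: "cell set \<Rightarrow> cell set \<Rightarrow> bool" where
  "ghost_step D E \<longleftrightarrow> (\<exists>r>0. E = ghost_move D r)"

definition GKD :: "cell set \<Rightarrow> cell set set" where
  "GKD D = {E. ghost_step\<^sup>*\<^sup>* D E}"

definition ghost_Kohnert_poset :: "cell set \<Rightarrow> cell set gorder" where
  "ghost_Kohnert_poset D =
     \<lparr>carrier = GKD D, eq = (=), le = (\<lambda>D\<^sub>2 D\<^sub>1. ghost_step\<^sup>*\<^sup>* D\<^sub>1 D\<^sub>2)\<rparr>"

definition minimal_in :: "'a gorder \<Rightarrow> 'a \<Rightarrow> bool" where
  "minimal_in P x \<longleftrightarrow> x \<in> carrier P \<and> (\<forall>y\<in>carrier P. y \<sqsubseteq>\<^bsub>P\<^esub> x \<longrightarrow> y = x)"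

definition maximal_in :: "'a gorder \<Rightarrow> 'a \<Rightarrow> bool" where
  "maximal_in P x \<longleftrightarrow> x \<in> carrier P \<and> (\<forall>y\<in>carrier P. x \<sqsubseteq>\<^bsub>P\<^esub> y \<longrightarrow> y = x)"

text \<open>Unlike the library's \<^locale>\<open>bounded_lattice\<close>, which asks for a least and a greatest
  element, boundedness here means a unique minimal and a unique maximal element.\<close>

definition bounded_poset :: "'a gorder \<Rightarrow> bool" where
  "bounded_poset P \<longleftrightarrow> (\<exists>!x. minimal_in P x) \<and> (\<exists>!x. maximal_in P x)"

end

theory Submission
  imports Defs
begin

text \<open>
  Label each move by the position that it turns into a ghost. A label is used at most once, and the
  poset order implies inclusion of ghost sets. Two moves available in the same diagram either
  commute, or one of them makes the other impossible forever; in the latter case two minimal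
  elements arise, one whose ghosts include the label of the blocked move and one whose ghosts do
  not. So if the poset is bounded, any two available moves commute, which makes the sets of used
  labels an antimatroid: the order is then reverse inclusion of ghost sets, these are closed
  under union, and hence meets exist. As there is a top element and everything is finite, joins
  exist as well.
\<close>

section \<open>Labelled transition systems with single-use labels\<close>

text \<open>The hypotheses are restricted to states reachable from \<open>x0\<close>, since for
  ghost moves they are verified only on diagrams. The common finite bound on \<open>used\<close>
  gives termination.\<close>

locale single_use_system =
  fixes tr :: "'s \<Rightarrow> 'a \<Rightarrow> 's \<Rightarrow> bool"
    and used :: "'s \<Rightarrow> 'a set"
    and x0 :: 's
    and steps :: "'s \<Rightarrow> 's \<Rightarrow> bool"
    and P :: "'s gorder"
  defines "steps \<equiv> (\<lambda>x y. \<exists>a. tr x a y)\<^sup>*\<^sup>*"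
  assumes carrier_P: "carrier P = {x. steps x0 x}"
    and eq_P: "eq P = (=)"
    and le_P: "\<lbrakk>steps x0 x; steps x0 y\<rbrakk> \<Longrightarrow> le P y x \<longleftrightarrow> steps x y"
    and used_bounded: "\<exists>B. finite B \<and> (\<forall>x. steps x0 x \<longrightarrow> used x \<subseteq> B)"
    and fresh: "\<lbrakk>steps x0 x; tr x a y\<rbrakk> \<Longrightarrow> a \<notin> used x"
    and used_tr: "\<lbrakk>steps x0 x; tr x a y\<rbrakk> \<Longrightarrow> used y = insert a (used x)"
begin

lemma steps_trans [trans]: "steps x y \<Longrightarrow> steps y z \<Longrightarrow> steps x z"
  unfolding steps_def by (rule rtranclp_trans)

lemma steps_refl [simp]: "steps x x"
  unfolding steps_def by simp

lemma steps_tr: "tr x a y \<Longrightarrow> steps x y"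
  unfolding steps_def by (intro r_into_rtranclp exI)

lemma steps_induct [consumes 1, case_names refl tr]:
  assumes "steps x y"
    and "\<And>x. Q x x"
    and "\<And>x a z y. tr x a z \<Longrightarrow> steps z y \<Longrightarrow> Q z y \<Longrightarrow> Q x y"
  shows "Q x y"
  using assms(1) unfolding steps_def
proof (induction rule: converse_rtranclp_induct)
  case (step x z)
  then show ?case using assms(3) unfolding steps_def by blast
qed (rule assms(2))

lemma used_mono: "steps x y \<Longrightarrow> steps x0 x \<Longrightarrow> used x \<subseteq> used y"
proof (induction rule: steps_induct)
  case (tr x a z y)
  then show ?case using used_tr[of x a z] steps_trans[OF tr.prems steps_tr] by blast
qed simp

text \<open>The first label of a nonempty run is missing from \<open>used x\<close> but stays in
  \<open>used y\<close>. This excludes cycles.\<close>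

lemma steps_used_eq: "steps x y \<Longrightarrow> steps x0 x \<Longrightarrow> used y \<subseteq> used x \<Longrightarrow> x = y"
proof (induction rule: steps_induct)
  case (tr x a z y)
  have "a \<in> used y"
    using used_tr[of x a z] used_mono[of z y] steps_trans[OF tr.prems(1) steps_tr] tr by blast
  then show ?case using fresh[of x a z] tr by blast
qed simp

lemma steps_antisym: "\<lbrakk>steps x y; steps y x; steps x0 x\<rbrakk> \<Longrightarrow> x = y"
  by (meson steps_used_eq used_mono steps_trans)

lemma finite_used: "steps x0 x \<Longrightarrow> finite (used x)"
  using used_bounded finite_subset by blast

lemma minimal_in_P: "minimal_in P x \<longleftrightarrow> steps x0 x \<and> (\<forall>y. steps x y \<longrightarrow> y = x)"
proof -
  have "minimal_in P x \<longleftrightarrow> steps x0 x \<and> (\<forall>y. steps x0 y \<and> steps x y \<longrightarrow> y = x)"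
    unfolding minimal_in_def carrier_P using le_P by blast
  then show ?thesis using steps_trans by blast
qed

text \<open>All elements lie below \<open>x0\<close>, so boundedness amounts to uniqueness of the
  minimal element.\<close>

lemma maximal_in_P: "maximal_in P x \<longleftrightarrow> x = x0"
proof -
  have "maximal_in P x \<longleftrightarrow> steps x0 x \<and> (\<forall>y. steps x0 y \<and> steps y x \<longrightarrow> y = x)"
    unfolding maximal_in_def carrier_P using le_P by blast
  then show ?thesis using steps_antisym steps_refl by blast
qed

text \<open>A state below \<open>x\<close> with the most used labels cannot be left, since every
  transition adds a label.\<close>

lemma minimal_below:
  assumes "steps x0 x"
  shows "\<exists>m. steps x m \<and> minimal_in P m"
proof -
  obtain B where B: "finite B" "\<And>y. steps x0 y \<Longrightarrow> used y \<subseteq> B"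
    using used_bounded by blast
  have "\<forall>y. steps x y \<longrightarrow> card (used y) < Suc (card B)"
    using B assms steps_trans by (meson card_mono le_imp_less_Suc)
  then obtain m where m: "steps x m" "\<And>y. steps x y \<Longrightarrow> card (used y) \<le> card (used m)"
    using ex_has_greatest_nat[of "steps x" x "\<lambda>y. card (used y)" "Suc (card B)"]
      steps_refl by blast
  have x0m: "steps x0 m" using assms m(1) steps_trans by blast
  have "y = m" if y: "steps m y" for y
  proof -
    have "used m \<subseteq> used y" using used_mono x0m y by blast
    moreover have "card (used y) \<le> card (used m)" using m y steps_trans by blast
    ultimately have "used m = used y"
      using card_seteq finite_used steps_trans x0m y by meson
    then show ?thesis using steps_used_eq[OF y x0m] by blast
  qed
  then show ?thesis using m(1) x0m minimal_in_P by blast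
qed

sublocale poset: partial_order P
  by unfold_locales (auto simp: carrier_P eq_P le_P intro: steps_antisym steps_trans)

text \<open>The meet of two minimal elements lies below both, hence equals both.\<close>

lemma lattice_imp_bounded:
  assumes "lattice P"
  shows "bounded_poset P"
proof -
  interpret lattice P by fact
  obtain m where m: "minimal_in P m" using minimal_below[of x0] by auto
  have "m' = m" if m': "minimal_in P m'" for m'
  proof -
    have carr: "m \<in> carrier P" "m' \<in> carrier P"
      using m m' by (auto simp: minimal_in_def)
    have "m \<sqinter>\<^bsub>P\<^esub> m' \<sqsubseteq>\<^bsub>P\<^esub> m" "m \<sqinter>\<^bsub>P\<^esub> m' \<sqsubseteq>\<^bsub>P\<^esub> m'" "m \<sqinter>\<^bsub>P\<^esub> m' \<in> carrier P"
      using carr by (auto intro: meet_left meet_right)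
    then have "m \<sqinter>\<^bsub>P\<^esub> m' = m" "m \<sqinter>\<^bsub>P\<^esub> m' = m'"
      using m m' by (auto simp: minimal_in_def)
    then show ?thesis by simp
  qed
  then show ?thesis using m unfolding bounded_poset_def maximal_in_P by blast
qed

text \<open>The minimal elements below \<open>y\<close> and below \<open>z\<close> coincide, and the
  latter has used \<open>b\<close>. So firing \<open>a\<close> cannot rule out \<open>b\<close>
  forever.\<close>

lemma bounded_imp_label_survives:
  assumes "bounded_poset P" and x: "steps x0 x" and y: "tr x a y" and z: "tr x b z"
  shows "\<exists>w. steps y w \<and> b \<in> used w"
proof -
  have x0y: "steps x0 y" and x0z: "steps x0 z"
    using steps_trans[OF x steps_tr] y z by blast+
  obtain m m' where m: "steps y m" "minimal_in P m" and m': "steps z m'" "minimal_in P m'"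
    using minimal_below x0y x0z by meson
  then have "m = m'" using assms(1) unfolding bounded_poset_def by blast
  moreover have "b \<in> used m'" using used_mono[OF m'(1) x0z] used_tr[OF x z] by blast
  ultimately show ?thesis using m(1) by blast
qed

end

section \<open>Commuting transitions and the resulting lattice\<close>

locale commuting_system = single_use_system +
  assumes det: "\<lbrakk>tr x a y; tr x a z\<rbrakk> \<Longrightarrow> y = z"
    and diamond: "\<lbrakk>steps x0 x; tr x a y; tr x b z; a \<noteq> b\<rbrakk> \<Longrightarrow> \<exists>w. tr y b w \<and> tr z a w"
begin

text \<open>The run to \<open>w\<close> must fire \<open>a\<close> at some point. The diamond moves
  \<open>a\<close> in front of each earlier label, and where the run itself fires \<open>a\<close>,
  determinism identifies the two successors.\<close>

lemma residual_steps:
  assumes "steps x w" "steps x0 x" "tr x a y" "a \<in> used w"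
  shows "steps y w"
  using assms
proof (induction arbitrary: y rule: steps_induct)
  case (refl x)
  then show ?case using fresh by blast
next
  case (tr x b z w)
  show ?case
  proof (cases "a = b")
    case True
    then show ?thesis using tr det by blast
  next
    case False
    then obtain v where v: "tr y b v" "tr z a v" using diamond tr by blast
    have "steps v w" using tr.IH[OF _ v(2)] tr.prems tr.hyps steps_trans steps_tr by blast
    then show ?thesis using v(1) steps_tr steps_trans by blast
  qed
qed

text \<open>The run to \<open>y\<close> is followed while \<open>w\<close> stays reachable: each of
  its labels lies in \<open>used y\<close>, hence in \<open>used w\<close>, so
  \<open>residual_steps\<close> applies.\<close>

lemma steps_if_used_subset:
  assumes "steps x y" "steps x0 x" "steps x w" "used y \<subseteq> used w"
  shows "steps y w"
  using assms
proof (induction rule: steps_induct)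
  case (tr x a z y)
  have z: "steps x0 z" using tr steps_trans steps_tr by blast
  then have "a \<in> used w" using used_mono[OF \<open>steps z y\<close>] used_tr tr by blast
  then show ?case using tr z residual_steps by blast
qed simp

lemma steps_iff_used_subset:
  assumes "steps x0 x" "steps x0 y"
  shows "steps x y \<longleftrightarrow> used x \<subseteq> used y"
  using assms steps_if_used_subset[of x0 x y] used_mono by auto

text \<open>The label \<open>a\<close> differs from every label on the run, so the diamond carries
  it across one transition at a time.\<close>

lemma tr_persists:
  assumes "steps x w" "steps x0 x" "tr x a y" "a \<notin> used w"
  shows "\<exists>v. tr w a v"
  using assms
proof (induction arbitrary: y rule: steps_induct)
  case (tr x b z w)
  have z: "steps x0 z" using tr steps_trans steps_tr by blast
  have "b \<in> used w" using used_mono[OF \<open>steps z w\<close> z] used_tr tr by blast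
  then have "a \<noteq> b" using tr by blast
  then show ?case using diamond[of x a y b z] tr z by blast
qed blast

text \<open>The run to \<open>y\<close> is replayed on top of \<open>w\<close>: labels already used
  by \<open>w\<close> are skipped, and any other is still enabled by \<open>tr_persists\<close> and
  is fired.\<close>

lemma used_union:
  assumes "steps x y" "steps x0 x" "steps x w"
  shows "\<exists>v. steps x0 v \<and> used v = used y \<union> used w"
  using assms
proof (induction arbitrary: w rule: steps_induct)
  case (refl x)
  then show ?case using used_mono[of x w] steps_trans by blast
next
  case (tr x a z y)
  have z: "steps x0 z" using tr steps_trans steps_tr by blast
  have w: "steps x0 w" using tr steps_trans by blast
  have a: "a \<in> used y" using used_mono[OF \<open>steps z y\<close> z] used_tr tr by blast
  show ?case
  proof (cases "a \<in> used w")
    case True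
    then show ?thesis using tr z residual_steps by blast
  next
    case False
    \<comment> \<open>From here \<open>v\<close> takes the role of \<open>w\<close>, which is why
      the induction generalises over \<open>w\<close>.\<close>
    then obtain v where v: "tr w a v" using tr tr_persists by blast
    have used_v: "used v = insert a (used w)" using used_tr w v by blast
    have "steps x v" using tr v steps_trans steps_tr by blast
    then have "steps z v" using tr used_v residual_steps by blast
    then obtain u where "steps x0 u" "used u = used y \<union> used v" using tr.IH z by blast
    then show ?thesis using used_v a by auto
  qed
qed

lemma greatest_Lower:
  assumes "steps x0 x" "steps x0 y"
  shows "\<exists>v. greatest P v (Lower P {x, y}) \<and> used v = used x \<union> used y"
proof -
  obtain v where v: "steps x0 v" "used v = used x \<union> used y"
    using used_union[of x0 x y] assms by auto
  have "Lower P {x, y} = {z. steps x0 z \<and> used x \<subseteq> used z \<and> used y \<subseteq> used z}"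
    unfolding Lower_def carrier_P using assms by (force simp: le_P steps_iff_used_subset)
  with v have "greatest P v (Lower P {x, y})"
    by (simp add: greatest_def carrier_P le_P steps_iff_used_subset subset_iff)
  then show ?thesis using v by blast
qed

text \<open>The intersection of the two label sets need not be reachable. The join is the largest
  reachable set contained in both: finiteness gives one of maximal size, and closure under unions
  makes it contain all the others.\<close>

lemma least_Upper:
  assumes x: "steps x0 x" and y: "steps x0 y"
  shows "\<exists>u. least P u (Upper P {x, y})"
proof -
  define Q where "Q u \<longleftrightarrow> steps x0 u \<and> used u \<subseteq> used x \<and> used u \<subseteq> used y" for u
  have Upper: "Upper P {x, y} = Collect Q"
    unfolding Upper_def carrier_P Q_def using x y by (force simp: le_P steps_iff_used_subset)
  have "Q x0" using used_mono x y Q_def by auto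
  moreover have "\<forall>u. Q u \<longrightarrow> card (used u) < Suc (card (used x))"
    using finite_used[OF x] card_mono unfolding Q_def by (auto simp: less_Suc_eq_le)
  ultimately obtain u where u: "Q u" "\<And>u'. Q u' \<Longrightarrow> card (used u') \<le> card (used u)"
    using ex_has_greatest_nat[of Q x0 "\<lambda>u. card (used u)" "Suc (card (used x))"] by blast
  have "used u' \<subseteq> used u" if u': "Q u'" for u'
  proof -
    obtain v where v: "steps x0 v" "used v = used u \<union> used u'"
      using used_union[of x0 u u'] u u' Q_def by auto
    then have "Q v" using u u' Q_def by auto
    \<comment> \<open>As \<open>v\<close> also satisfies \<open>Q\<close>, maximality of
      \<open>card (used u)\<close> means that the union adds nothing.\<close>
    then have "used u = used v"
      using u(2)[of v] v finite_used[OF v(1)] card_seteq[of "used v" "used u"] by blast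
    then show ?thesis using v by blast
  qed
  then have "least P u (Upper P {x, y})"
    unfolding Upper least_def using u(1) by (auto simp: Q_def carrier_P le_P steps_iff_used_subset)
  then show ?thesis by blast
qed

lemma lattice: "lattice P"
  by unfold_locales (use least_Upper greatest_Lower carrier_P in blast)+

end

section \<open>Ghost moves as labelled transitions\<close>

text \<open>This form avoids \<open>Max\<close>: ordinary cells strictly between \<open>s\<close>
  and \<open>r\<close> say at once that \<open>s\<close> is the highest empty row below
  \<open>r\<close> and that no ghost lies in between. On diagrams it captures exactly the moves that
  change something.\<close>

definition effective_move :: "cell set \<Rightarrow> nat \<Rightarrow> nat \<Rightarrow> nat \<Rightarrow> bool" where
  "effective_move D r c s \<longleftrightarrow>
     Ordinary r c \<in> D \<and> (\<forall>c'>c. empty_position D r c') \<and>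
     0 < s \<and> s < r \<and> empty_position D s c \<and> (\<forall>t. s < t \<and> t < r \<longrightarrow> Ordinary t c \<in> D)"

definition drop_cell :: "cell set \<Rightarrow> nat \<Rightarrow> nat \<Rightarrow> nat \<Rightarrow> cell set" where
  "drop_cell D r c s = (D - {Ordinary r c}) \<union> {Ordinary s c, Ghost r c}"

definition ghost_trans :: "cell set \<Rightarrow> nat \<times> nat \<Rightarrow> cell set \<Rightarrow> bool" where
  "ghost_trans D a E \<longleftrightarrow>
     (\<exists>s. effective_move D (fst a) (snd a) s \<and> E = drop_cell D (fst a) (snd a) s)"

definition ghost_positions :: "cell set \<Rightarrow> (nat \<times> nat) set" where
  "ghost_positions D = {(r, c). Ghost r c \<in> D}"

lemma effective_move_target_unique:
  assumes "effective_move D r c s" "effective_move D r c t"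
  shows "s = t"
  using assms unfolding effective_move_def empty_position_def by (metis linorder_neqE_nat)

lemma effective_move_column_unique:
  assumes "effective_move D r c s" "effective_move D r d t"
  shows "c = d"
  using assms unfolding effective_move_def empty_position_def by (metis linorder_neqE_nat)

lemma finite_row_columns:
  assumes "finite D"
  shows "finite (row_columns D r)"
proof -
  have "row_columns D r \<subseteq> cell_col ` D"
    unfolding row_columns_def empty_position_def by (force simp: image_iff)
  then show ?thesis using assms finite_subset by blast
qed

lemma finite_empty_rows_below: "finite (empty_rows_below D r c)"
  by (rule finite_subset[of _ "{..<r}"]) (auto simp: empty_rows_below_def)

text \<open>The conditions determine both \<open>Max\<close> values in \<open>ghost_move\<close>,
  and disjointness of ordinary and ghost cells excludes its idle cases.\<close>

lemma ghost_move_effective: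
  assumes "is_diagram D" "effective_move D r c s"
  shows "ghost_move D r = drop_cell D r c s"
proof -
  note e = assms(2)[unfolded effective_move_def]
  have fin: "finite D" and disj: "\<And>r c. \<not> (Ordinary r c \<in> D \<and> Ghost r c \<in> D)"
    using assms(1) by (auto simp: is_diagram_def)
  have c: "c \<in> row_columns D r" using e by (auto simp: row_columns_def empty_position_def)
  have "Max (row_columns D r) = c"
  proof (rule Max_eqI[OF finite_row_columns[OF fin] _ c])
    show "d \<le> c" if "d \<in> row_columns D r" for d
      using e that unfolding row_columns_def by (metis linorder_not_le mem_Collect_eq)
  qed
  moreover have s: "s \<in> empty_rows_below D r c" using e by (auto simp: empty_rows_below_def)
  moreover have "Max (empty_rows_below D r c) = s"
  proof (rule Max_eqI[OF finite_empty_rows_below _ s])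
    show "t \<le> s" if "t \<in> empty_rows_below D r c" for t
      using e that unfolding empty_rows_below_def empty_position_def
      by (metis (mono_tags, lifting) linorder_not_le mem_Collect_eq)
  qed
  moreover have "\<not> (\<exists>t. s < t \<and> t < r \<and> Ghost t c \<in> D)" "Ghost r c \<notin> D"
    using e disj by blast+
  ultimately show ?thesis
    using c unfolding ghost_move_def drop_cell_def Let_def by auto
qed

text \<open>Positions between \<open>Max S\<close> and \<open>r\<close> are occupied by maximality,
  and not by ghosts because the move is not idle.\<close>

lemma ghost_move_cases:
  assumes "is_diagram D" "ghost_move D r \<noteq> D"
  obtains c s where "effective_move D r c s"
proof -
  define c where "c = Max (row_columns D r)"
  define S where "S = empty_rows_below D r c"
  have ne: "row_columns D r \<noteq> {}" and *: "Ghost r c \<notin> D" "S \<noteq> {}"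
    "\<not> (\<exists>t. Max S < t \<and> t < r \<and> Ghost t c \<in> D)"
    using assms(2) unfolding ghost_move_def c_def S_def Let_def by metis+
  have fin: "finite (row_columns D r)"
    using assms(1) finite_row_columns is_diagram_def by blast
  have "c \<in> row_columns D r" unfolding c_def using fin ne by (rule Max_in)
  then have o: "Ordinary r c \<in> D"
    using *(1) by (auto simp: row_columns_def empty_position_def)
  have right: "empty_position D r c'" if "c' > c" for c'
    using that Max_ge[OF fin, of c'] unfolding c_def row_columns_def by force
  have S: "Max S \<in> S" using *(2) by (simp add: S_def finite_empty_rows_below)
  have "Ordinary t c \<in> D" if t: "Max S < t" "t < r" for t
  proof -
    have "t \<notin> S" using t Max_ge[of S t] S_def finite_empty_rows_below by (metis not_le)
    then have "\<not> empty_position D t c" using t by (simp add: S_def empty_rows_below_def)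
    then show ?thesis using t *(3) by (auto simp: empty_position_def)
  qed
  then have "effective_move D r c (Max S)"
    using o right S unfolding effective_move_def S_def empty_rows_below_def by auto
  then show thesis by (rule that)
qed

lemma is_diagram_drop_cell:
  assumes "is_diagram D" "effective_move D r c s"
  shows "is_diagram (drop_cell D r c s)"
proof -
  have D: "finite D" "\<And>x. x \<in> D \<Longrightarrow> 0 < cell_row x \<and> 0 < cell_col x"
    "\<And>r c. \<not> (Ordinary r c \<in> D \<and> Ghost r c \<in> D)"
    using assms(1) by (auto simp: is_diagram_def)
  have e: "Ordinary r c \<in> D" "0 < s" "s < r" "Ghost s c \<notin> D"
    using assms(2) by (auto simp: effective_move_def empty_position_def)
  have "0 < cell_row x \<and> 0 < cell_col x" if "x \<in> drop_cell D r c s" for x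
    using that D(2)[of x] D(2)[OF e(1)] e by (auto simp: drop_cell_def)
  then show ?thesis
    using D(1,3) e unfolding is_diagram_def by (auto simp: drop_cell_def)
qed

lemma ghost_step_iff:
  assumes "is_diagram D"
  shows "ghost_step D E \<longleftrightarrow> E = D \<or> (\<exists>a. ghost_trans D a E)"
proof
  assume "ghost_step D E"
  then obtain r where r: "E = ghost_move D r" by (auto simp: ghost_step_def)
  show "E = D \<or> (\<exists>a. ghost_trans D a E)"
  proof (cases "E = D")
    case False
    then obtain c s where m: "effective_move D r c s"
      using r assms ghost_move_cases by metis
    then have "ghost_trans D (r, c) E"
      using r assms ghost_move_effective by (auto simp: ghost_trans_def)
    then show ?thesis by blast
  qed simp
next
  assume *: "E = D \<or> (\<exists>a. ghost_trans D a E)"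
  show "ghost_step D E"
  proof (cases "E = D")
    case True
    \<comment> \<open>A row above all cells is empty, so its move is idle; \<open>Suc N\<close> is
      moreover positive, as a row number must be.\<close>
    obtain N where N: "\<forall>x\<in>cell_row ` D. x < N"
      using assms finite_nat_set_iff_bounded[of "cell_row ` D"] by (auto simp: is_diagram_def)
    have "row_columns D (Suc N) = {}"
      using N unfolding row_columns_def empty_position_def by fastforce
    then have "ghost_move D (Suc N) = D" by (simp add: ghost_move_def)
    then show ?thesis using True unfolding ghost_step_def by (metis zero_less_Suc)
  next
    case False
    then obtain r c s where m: "effective_move D r c s" "E = drop_cell D r c s"
      using * by (auto simp: ghost_trans_def)
    then have "r > 0" by (auto simp: effective_move_def)
    then show ?thesis using m ghost_move_effective[OF assms] unfolding ghost_step_def by metis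
  qed
qed

section \<open>Reachability by effective moves\<close>

abbreviation ghost_reach :: "cell set \<Rightarrow> cell set \<Rightarrow> bool" where
  "ghost_reach \<equiv> (\<lambda>D E. \<exists>a. ghost_trans D a E)\<^sup>*\<^sup>*"

lemma is_diagram_ghost_reach:
  assumes "ghost_reach D E" "is_diagram D"
  shows "is_diagram E"
  using assms
  by (induction rule: rtranclp_induct) (auto simp: ghost_trans_def is_diagram_drop_cell)

text \<open>Idle moves disappear in the reflexive transitive closure.\<close>

lemma ghost_steps_iff:
  assumes D: "is_diagram D"
  shows "ghost_step\<^sup>*\<^sup>* D E \<longleftrightarrow> ghost_reach D E"
proof
  assume "ghost_step\<^sup>*\<^sup>* D E"
  then show "ghost_reach D E"
  proof (induction rule: rtranclp_induct)
    case (step y z)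
    then have "is_diagram y" using D is_diagram_ghost_reach by blast
    then show ?case using step ghost_step_iff rtranclp.rtrancl_into_rtrancl by metis
  qed simp
next
  assume "ghost_reach D E"
  then show "ghost_step\<^sup>*\<^sup>* D E"
  proof (induction rule: rtranclp_induct)
    case (step y z)
    then have "is_diagram y" using D is_diagram_ghost_reach by blast
    then show ?case using step ghost_step_iff rtranclp.rtrancl_into_rtrancl by metis
  qed simp
qed

text \<open>Cells move down within their column and ghosts appear where a cell stood, so a bounding
  box persists. It confines all labels to a finite set.\<close>

lemma cells_bounded_ghost_reach:
  assumes "ghost_reach D E" "\<forall>x\<in>D. cell_row x \<le> N \<and> cell_col x \<le> N"
  shows "\<forall>x\<in>E. cell_row x \<le> N \<and> cell_col x \<le> N"
  using assms
proof (induction rule: rtranclp_induct)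
  case (step y z)
  then obtain r c s where m: "Ordinary r c \<in> y" "s < r" "z = drop_cell y r c s"
    unfolding ghost_trans_def effective_move_def by blast
  moreover from m step have "r \<le> N" "c \<le> N" by force+
  ultimately show ?case using step by (auto simp: drop_cell_def)
qed

section \<open>Blocked cells and commuting moves\<close>

text \<open>Sufficient conditions for the cell in position \<open>(r, c)\<close> to stay put forever.\<close>

definition blocked :: "cell set \<Rightarrow> nat \<Rightarrow> nat \<Rightarrow> bool" where
  "blocked D r c \<longleftrightarrow>
     (\<exists>c'>c. \<not> empty_position D r c') \<or>
     (\<exists>t<r. Ghost t c \<in> D \<and> (\<forall>u. t < u \<and> u < r \<longrightarrow> \<not> empty_position D u c))"

text \<open>The vacated position receives a ghost, so no position ever becomes empty.\<close>

lemma empty_position_drop_cell: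
  "empty_position (drop_cell D r c s) u d \<Longrightarrow> Ordinary r c \<in> D \<Longrightarrow> empty_position D u d"
  by (auto simp: empty_position_def drop_cell_def)

lemma blocked_drop_cell:
  assumes "blocked D r c" "Ordinary r' c' \<in> D"
  shows "blocked (drop_cell D r' c' s) r c"
proof -
  have "Ghost t c \<in> D \<Longrightarrow> Ghost t c \<in> drop_cell D r' c' s" for t
    by (simp add: drop_cell_def)
  then show ?thesis
    using assms empty_position_drop_cell unfolding blocked_def by meson
qed

text \<open>In the second alternative, a target below \<open>t\<close> would require an ordinary
  cell where the ghost is, and a target at or above \<open>t\<close> would be occupied.\<close>

lemma blocked_not_effective:
  assumes "is_diagram D" "blocked D r c"
  shows "\<not> effective_move D r c s"
  using assms unfolding blocked_def effective_move_def empty_position_def is_diagram_def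
  by (metis linorder_neqE_nat)

text \<open>Only the move of the cell at \<open>(r, c)\<close> could create this ghost, and the
  block, which persists, prevents that move at every stage.\<close>

lemma blocked_ghost_reach:
  assumes "ghost_reach D E" "is_diagram D" "blocked D r c" "Ghost r c \<notin> D"
  shows "blocked E r c \<and> Ghost r c \<notin> E"
  using assms
proof (induction rule: rtranclp_induct)
  case (step y z)
  then have y: "is_diagram y" "blocked y r c" "Ghost r c \<notin> y"
    using is_diagram_ghost_reach by blast+
  obtain r' c' s where m: "effective_move y r' c' s" "z = drop_cell y r' c' s"
    using step by (auto simp: ghost_trans_def)
  have "(r', c') \<noteq> (r, c)" using m y blocked_not_effective by blast
  then have "Ghost r c \<notin> z" using m y by (auto simp: drop_cell_def)
  moreover have "blocked z r c" using m y blocked_drop_cell by (simp add: effective_move_def)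
  ultimately show ?case by blast
qed simp

text \<open>The second move even keeps its target. In different columns only a cell landing to the
  right in row \<open>r2\<close> could interfere, which \<open>b1\<close> excludes; in the same
  column the row intervals from target to source are disjoint.\<close>

lemma effective_move_drop_cell:
  assumes m1: "effective_move D r1 c1 s1" and m2: "effective_move D r2 c2 s2"
    and neq: "(r1, c1) \<noteq> (r2, c2)"
    and b1: "\<not> blocked (drop_cell D r1 c1 s1) r2 c2"
    and b2: "\<not> blocked (drop_cell D r2 c2 s2) r1 c1"
  shows "effective_move (drop_cell D r1 c1 s1) r2 c2 s2"
proof -
  note e1 = m1[unfolded effective_move_def] and e2 = m2[unfolded effective_move_def]
  have rows: "r1 \<noteq> r2" using m1 m2 neq effective_move_column_unique by blast
  have right: "\<forall>c'>c2. empty_position (drop_cell D r1 c1 s1) r2 c'"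
    using b1 unfolding blocked_def by blast
  have same_column: "r1 < s2 \<or> r2 < s1" if c: "c1 = c2"
  proof (rule ccontr)
    have ghosts: "Ghost r1 c1 \<in> drop_cell D r1 c1 s1" "Ghost r2 c2 \<in> drop_cell D r2 c2 s2"
      by (auto simp: drop_cell_def)
    assume "\<not> (r1 < s2 \<or> r2 < s1)"
    then have "s2 \<le> r1" "s1 \<le> r2" by auto
    moreover have "s2 \<noteq> r1" "s1 \<noteq> r2" using e1 e2 c by (auto simp: empty_position_def)
    ultimately have lt: "s2 < r1" "s1 < r2" by auto
    \<comment> \<open>The lower source lies strictly inside the range of the higher move. Once it is
      a ghost, it blocks the higher source, as all positions between them are occupied.\<close>
    show False
    proof (cases "r1 < r2")
      case True
      have "\<forall>u. r1 < u \<and> u < r2 \<longrightarrow> \<not> empty_position (drop_cell D r1 c1 s1) u c2"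
        using e2 lt True by (auto simp: empty_position_def drop_cell_def)
      then show False using b1 True ghosts c unfolding blocked_def by blast
    next
      case False
      then have "r2 < r1" using rows by simp
      moreover have "\<forall>u. r2 < u \<and> u < r1 \<longrightarrow> \<not> empty_position (drop_cell D r2 c2 s2) u c1"
        using e1 lt by (auto simp: empty_position_def drop_cell_def)
      ultimately show False using b2 ghosts c unfolding blocked_def by blast
    qed
  qed
  \<comment> \<open>So the first move neither fills the target of the second nor puts a ghost on its
    way.\<close>
  then have "s1 \<noteq> s2 \<or> c1 \<noteq> c2" "r1 \<noteq> s2 \<or> c1 \<noteq> c2"
    "\<And>t. s2 < t \<Longrightarrow> t < r2 \<Longrightarrow> t \<noteq> r1 \<or> c1 \<noteq> c2"
    using e1 e2 by auto
  then show ?thesis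
    using e1 e2 right rows unfolding effective_move_def
    by (auto simp: drop_cell_def empty_position_def)
qed

text \<open>Sources are occupied and targets empty, so neither drop removes the cell that the other
  one places.\<close>

lemma drop_cell_commute:
  assumes "effective_move D r1 c1 s1" "effective_move D r2 c2 s2"
  shows "drop_cell (drop_cell D r1 c1 s1) r2 c2 s2 = drop_cell (drop_cell D r2 c2 s2) r1 c1 s1"
proof -
  have "Ordinary s1 c1 \<noteq> Ordinary r2 c2" "Ordinary s2 c2 \<noteq> Ordinary r1 c1"
    using assms by (auto simp: effective_move_def empty_position_def)
  then show ?thesis by (auto simp: drop_cell_def)
qed

section \<open>The ghost Kohnert poset as a transition system\<close>

lemma ghost_trans_single_use:
  assumes D: "is_diagram D"
  shows "single_use_system ghost_trans ghost_positions D (ghost_Kohnert_poset D)"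
proof
  show "carrier (ghost_Kohnert_poset D) = {E. ghost_reach D E}"
    using D ghost_steps_iff by (simp add: ghost_Kohnert_poset_def GKD_def)
  show "eq (ghost_Kohnert_poset D) = (=)"
    by (simp add: ghost_Kohnert_poset_def)
  show "le (ghost_Kohnert_poset D) F E \<longleftrightarrow> ghost_reach E F"
    if "ghost_reach D E" "ghost_reach D F" for E F
    using that D is_diagram_ghost_reach ghost_steps_iff by (simp add: ghost_Kohnert_poset_def)
next
  obtain N1 N2 where N: "\<forall>x\<in>cell_row ` D. x \<le> N1" "\<forall>x\<in>cell_col ` D. x \<le> N2"
    using D by (metis finite_imageI finite_nat_set_iff_bounded_le is_diagram_def)
  \<comment> \<open>A square that contains the initial diagram contains all reachable ones, hence
    all labels.\<close>
  let ?N = "max N1 N2"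
  have "\<forall>x\<in>D. cell_row x \<le> ?N \<and> cell_col x \<le> ?N" using N by (auto simp: le_max_iff_disj)
  then have "\<forall>x\<in>E. cell_row x \<le> ?N \<and> cell_col x \<le> ?N" if "ghost_reach D E" for E
    using that cells_bounded_ghost_reach by blast
  then have "\<forall>E. ghost_reach D E \<longrightarrow> ghost_positions E \<subseteq> {..?N} \<times> {..?N}"
    unfolding ghost_positions_def by fastforce
  then show "\<exists>B. finite B \<and> (\<forall>E. ghost_reach D E \<longrightarrow> ghost_positions E \<subseteq> B)"
    by (meson finite_SigmaI finite_atMost)
next
  fix E a F
  assume E: "ghost_reach D E" and "ghost_trans E a F"
  then obtain r c s where m: "a = (r, c)" "effective_move E r c s" "F = drop_cell E r c s"
    unfolding ghost_trans_def by (metis prod.collapse)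
  have "is_diagram E" using D E is_diagram_ghost_reach by blast
  then show "a \<notin> ghost_positions E"
    using m by (auto simp: is_diagram_def ghost_positions_def effective_move_def)
  show "ghost_positions F = insert a (ghost_positions E)"
    using m by (auto simp: ghost_positions_def drop_cell_def)
qed

text \<open>Boundedness excludes blocking: after either move the label of the other must remain
  attainable, whereas a blocked cell never becomes a ghost. Moves that do not block each other
  commute.\<close>

lemma ghost_trans_commuting:
  assumes D: "is_diagram D" and bounded: "bounded_poset (ghost_Kohnert_poset D)"
  shows "commuting_system ghost_trans ghost_positions D (ghost_Kohnert_poset D)"
proof -
  interpret single_use_system ghost_trans ghost_positions D ghost_reach "ghost_Kohnert_poset D"
    by (rule ghost_trans_single_use[OF D])
  have not_blocked: "\<not> blocked (drop_cell E r1 c1 s1) r2 c2"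
    if E: "ghost_reach D E" and m: "effective_move E r1 c1 s1" "effective_move E r2 c2 s2"
      and neq: "(r1, c1) \<noteq> (r2, c2)" for E r1 c1 s1 r2 c2 s2
  proof
    assume blocked: "blocked (drop_cell E r1 c1 s1) r2 c2"
    have diagram: "is_diagram E" using D E is_diagram_ghost_reach by blast
    \<comment> \<open>The blocked cell is not a ghost at the start, as
      \<open>blocked_ghost_reach\<close> demands: the only new ghost is at the other, distinct
      position.\<close>
    then have "Ghost r2 c2 \<notin> drop_cell E r1 c1 s1"
      using m(2) neq by (auto simp: effective_move_def drop_cell_def is_diagram_def)
    moreover obtain F where "ghost_reach (drop_cell E r1 c1 s1) F" "(r2, c2) \<in> ghost_positions F"
      using bounded_imp_label_survives[OF bounded E, of "(r1, c1)" _ "(r2, c2)"] m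
      by (auto simp: ghost_trans_def)
    ultimately show False
      using blocked_ghost_reach[OF _ is_diagram_drop_cell[OF diagram m(1)] blocked]
      by (auto simp: ghost_positions_def)
  qed
  show ?thesis
  proof
    show "F = F'" if "ghost_trans E a F" "ghost_trans E a F'" for E a F F'
      using that effective_move_target_unique unfolding ghost_trans_def by metis
    show "\<exists>H. ghost_trans F b H \<and> ghost_trans F' a H"
      if E: "ghost_reach D E" and tr: "ghost_trans E a F" "ghost_trans E b F'" and neq: "a \<noteq> b"
      for E a F b F'
    proof -
      obtain r1 c1 s1 r2 c2 s2 where
        m1: "a = (r1, c1)" "effective_move E r1 c1 s1" "F = drop_cell E r1 c1 s1" and
        m2: "b = (r2, c2)" "effective_move E r2 c2 s2" "F' = drop_cell E r2 c2 s2"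
        using tr unfolding ghost_trans_def by (metis prod.collapse)
      have ne: "(r1, c1) \<noteq> (r2, c2)" using neq m1 m2 by simp
      note b1 = not_blocked[OF E m1(2) m2(2) ne] and b2 = not_blocked[OF E m2(2) m1(2) ne[symmetric]]
      have "effective_move F r2 c2 s2" "effective_move F' r1 c1 s1"
        using effective_move_drop_cell[OF m1(2) m2(2) ne b1 b2]
          effective_move_drop_cell[OF m2(2) m1(2) ne[symmetric] b2 b1] m1 m2 by auto
      then show ?thesis
        using drop_cell_commute[OF m1(2) m2(2)] m1 m2 by (auto simp: ghost_trans_def)
    qed
  qed
qed

theorem theorem3p11:
  fixes D :: "cell set"
  assumes "is_diagram D"
    and "card (ghost_cells D) = 0"
  shows "lattice (ghost_Kohnert_poset D) \<longleftrightarrow> bounded_poset (ghost_Kohnert_poset D)"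
proof
  assume "lattice (ghost_Kohnert_poset D)"
  with ghost_trans_single_use[OF assms(1)] show "bounded_poset (ghost_Kohnert_poset D)"
    by (rule single_use_system.lattice_imp_bounded)
next
  assume "bounded_poset (ghost_Kohnert_poset D)"
  with assms(1) have "commuting_system ghost_trans ghost_positions D (ghost_Kohnert_poset D)"
    by (rule ghost_trans_commuting)
  then show "lattice (ghost_Kohnert_poset D)"
    by (rule commuting_system.lattice)
qed

end
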